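(* Let $t$ be a non-negative integer, let $H$ be a $t$-tree, let $P$ be a path, and let $G$ be a subgraph of the strong product $H\boxtimes P$. Then $G$ has a proper odd colouring that uses at most $8t+4$ colours.
   Context: All graphs are finite and simple. A $t$-tree is a graph that is either a clique on $t+1$ vertices, or a graph $H$ containing a vertex $v$ of degree $t$ whose neighbours form a clique and such that $H-\{v\}$ is a $t$-tree. For graphs $A$ and $B$, the strong product $A\boxtimes B$ has vertex set $V(A)\times V(B)$, and $(x_1,y_1)(x_2,y_2)$ is an edge iff (i) $x_1x_2\in E(A)$ and $y_1=y_2$, or (ii) $x_1=x_2$ and $y_1y_2\in E(B)$, or (iii) $x_1x_2\in E(A)$ and $y_1y_2\in E(B)$. A vertex colouring $\varphi:V(G)\to\mathbb{N}$ (not necessarily proper) is odd if for every vertex $v$ with $|N_G(v)|>0$ there is a colour $\alpha$ such that $|\{w\in N_G(v):\varphi(w)=\alpha\}|$ is odd. It is proper if $vw\in E(G)$ implies $\varphi(v)\neq\varphi(w)$. A colouring uses $c$ colours if $|\{\varphi(v):v\in V(G)\}|=c$. *)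

theory Defs
  imports "Graph_Theory.Graph_Theory"
begin

text \<open>
  Finite simple graphs are the \<^locale>\<open>pair_graph\<close>s: finite, loop-free digraphs whose
  arc relation is symmetric, so an edge \<open>uv\<close> is the pair of arcs \<open>(u, v)\<close>, \<open>(v, u)\<close>.
\<close>

definition neighbourhood :: "'a pair_pre_digraph \<Rightarrow> 'a \<Rightarrow> 'a set" where
  "neighbourhood G v = {w. (v, w) \<in> parcs G}"

definition forms_clique :: "'a pair_pre_digraph \<Rightarrow> 'a set \<Rightarrow> bool" where
  "forms_clique G S \<longleftrightarrow> S \<subseteq> pverts G \<and> (\<forall>x\<in>S. \<forall>y\<in>S. x \<noteq> y \<longrightarrow> (x, y) \<in> parcs G)"

definition delete_vertex :: "'a pair_pre_digraph \<Rightarrow> 'a \<Rightarrow> 'a pair_pre_digraph" where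
  "delete_vertex G v =
    \<lparr>pverts = pverts G - {v}, parcs = {(x, y) \<in> parcs G. x \<noteq> v \<and> y \<noteq> v}\<rparr>"

inductive t_tree :: "nat \<Rightarrow> 'a pair_pre_digraph \<Rightarrow> bool" for t :: nat where
  clique: "K\<^bsub>t + 1\<^esub> (with_proj H) \<Longrightarrow> t_tree t H"
| extend: "\<lbrakk>pair_graph H; v \<in> pverts H; card (neighbourhood H v) = t;
    forms_clique H (neighbourhood H v); t_tree t (delete_vertex H v)\<rbrakk> \<Longrightarrow> t_tree t H"

definition path_graph :: "'a pair_pre_digraph \<Rightarrow> bool" where
  "path_graph P \<longleftrightarrow> (\<exists>xs. xs \<noteq> [] \<and> distinct xs \<and> pverts P = set xs \<and>
    parcs P = {(xs ! i, xs ! j) | i j.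
      i < length xs \<and> j < length xs \<and> (j = Suc i \<or> i = Suc j)})"

definition strong_product ::
  "'a pair_pre_digraph \<Rightarrow> 'b pair_pre_digraph \<Rightarrow> ('a \<times> 'b) pair_pre_digraph"
  (infixl \<open>\<boxtimes>\<close> 70) where
  "A \<boxtimes> B = \<lparr>pverts = pverts A \<times> pverts B,
    parcs = {((x1, y1), (x2, y2)) | x1 y1 x2 y2.
      (x1, y1) \<in> pverts A \<times> pverts B \<and> (x2, y2) \<in> pverts A \<times> pverts B \<and>
      ((x1, x2) \<in> parcs A \<and> y1 = y2 \<or>
       x1 = x2 \<and> (y1, y2) \<in> parcs B \<or>
       (x1, x2) \<in> parcs A \<and> (y1, y2) \<in> parcs B)}\<rparr>"

definition proper_colouring :: "'a pair_pre_digraph \<Rightarrow> ('a \<Rightarrow> nat) \<Rightarrow> bool" where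
  "proper_colouring G \<phi> \<longleftrightarrow> (\<forall>(v, w) \<in> parcs G. \<phi> v \<noteq> \<phi> w)"

definition odd_colouring :: "'a pair_pre_digraph \<Rightarrow> ('a \<Rightarrow> nat) \<Rightarrow> bool" where
  "odd_colouring G \<phi> \<longleftrightarrow> (\<forall>v \<in> pverts G. card (neighbourhood G v) > 0 \<longrightarrow>
    (\<exists>\<alpha>. odd (card {w \<in> neighbourhood G v. \<phi> w = \<alpha>})))"

definition num_colours :: "'a pair_pre_digraph \<Rightarrow> ('a \<Rightarrow> nat) \<Rightarrow> nat" where
  "num_colours G \<phi> = card {\<phi> v | v. v \<in> pverts G}"

end

theory Submission
  imports Defs "HOL-Library.Product_Lexorder"
begin

text \<open>
  Colour the vertices of \<open>G\<close> greedily along a linear order, where \<open>w\<close> avoids the colours of its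
  earlier neighbours and, for each neighbour \<open>u\<close>, that of the first neighbour of \<open>u\<close> if it is
  earlier than \<open>w\<close>. The colouring is proper, and the colour of the first neighbour of any vertex
  \<open>u\<close> occurs exactly once around \<open>u\<close>. It remains to find an order with few conflicts.

  Order the columns \<open>V(H)\<close> by an elimination order of the \<open>t\<close>-tree and the vertices of
  \<open>H \<boxtimes> P\<close> lexicographically, by column and then by layer. Let \<open>w = (y, j)\<close>, let \<open>u = (x, i)\<close> be a
  neighbour of \<open>w\<close>, and let the first neighbour \<open>f\<close> of \<open>u\<close> be earlier than \<open>w\<close>. If \<open>x\<close> precedes
  \<open>y\<close> in \<open>H\<close>, there are at most \<open>3t\<close> choices for \<open>u\<close>, hence for \<open>f\<close>. Otherwise the columns of \<open>f\<close>
  and \<open>w\<close> lie in the clique formed by \<open>x\<close> and its earlier neighbours, so \<open>f\<close> is in column \<open>y\<close> or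
  in one of the at most \<open>t\<close> earlier neighbouring columns of \<open>y\<close>, at most two layers away from
  \<open>w\<close>. With the earlier neighbours of \<open>w\<close>, which are there too, this makes at most
  \<open>2 + 5t + 3t\<close> conflicts.
\<close>

lemma (in pair_graph) neighbourhoodD:
  assumes "v \<in> neighbourhood G u"
  shows "u \<in> pverts G" "v \<in> pverts G" "u \<noteq> v" "u \<in> neighbourhood G v"
  using assms
  by (auto simp: neighbourhood_def intro: in_arcsD1 in_arcsD2 arcs_symmetric dest: no_loops')

lemma (in pair_graph) finite_neighbourhood: "finite (neighbourhood G u)"
  by (rule finite_subset[OF _ pair_finite_verts]) (auto dest: neighbourhoodD)


subsection \<open>Greedy proper odd colourings\<close>

lemma greedy_colouring:
  fixes r :: "'a \<Rightarrow> 'b::linorder" and avoid :: "'a \<Rightarrow> 'a set"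
  assumes "finite V"
    and "\<And>v. v \<in> V \<Longrightarrow> finite (avoid v)"
    and "\<And>v. v \<in> V \<Longrightarrow> card (avoid v) \<le> k"
    and "\<And>v u. v \<in> V \<Longrightarrow> u \<in> avoid v \<Longrightarrow> r u < r v"
  shows "\<exists>\<phi> :: 'a \<Rightarrow> nat. \<forall>v\<in>V. \<phi> v \<le> k \<and> \<phi> v \<notin> \<phi> ` avoid v"
  using assms
proof (induction V rule: finite_ranking_induct[where f = r])
  case (insert v V)
  then obtain \<phi> :: "'a \<Rightarrow> nat" where greedy: "\<forall>w\<in>V. \<phi> w \<le> k \<and> \<phi> w \<notin> \<phi> ` avoid w"
    by auto
  have "card (\<phi> ` avoid v) < card {..k}"
    using insert.prems(1,2)[of v] card_image_le[of "avoid v" \<phi>] by simp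
  then have "\<not> {..k} \<subseteq> \<phi> ` avoid v"
    using insert.prems(1)[of v] card_mono[of "\<phi> ` avoid v" "{..k}"] by auto
  then obtain c where fresh: "c \<le> k" "c \<notin> \<phi> ` avoid v"
    by auto
  have "v \<notin> avoid w" if "w \<in> insert v V" for w
    using insert.prems(3)[OF that] insert.hyps(2) that by fastforce
  then have "(\<phi>(v := c)) ` avoid w = \<phi> ` avoid w" if "w \<in> insert v V" for w
    using that by (intro image_cong) auto
  with greedy fresh show ?case
    by (intro exI[of _ "\<phi>(v := c)"]) simp
qed simp

definition earlier_neighbours :: "'a pair_pre_digraph \<Rightarrow> ('a \<Rightarrow> 'b::linorder) \<Rightarrow> 'a \<Rightarrow> 'a set" where
  "earlier_neighbours G r v = {u \<in> neighbourhood G v. r u < r v}"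

definition first_neighbour :: "'a pair_pre_digraph \<Rightarrow> ('a \<Rightarrow> 'b::linorder) \<Rightarrow> 'a \<Rightarrow> 'a" where
  "first_neighbour G r u = arg_min_on r (neighbourhood G u)"

definition conflicts :: "'a pair_pre_digraph \<Rightarrow> ('a \<Rightarrow> 'b::linorder) \<Rightarrow> 'a \<Rightarrow> 'a set" where
  "conflicts G r w = earlier_neighbours G r w \<union>
    {f \<in> first_neighbour G r ` neighbourhood G w. r f < r w}"

lemma (in pair_graph) finite_earlier_neighbours: "finite (earlier_neighbours G r v)"
  using finite_neighbourhood by (simp add: earlier_neighbours_def)

lemma (in pair_graph) earlier_neighbours_cases:
  assumes "inj_on r (pverts G)" "v \<in> neighbourhood G u"
  obtains "v \<in> earlier_neighbours G r u" | "u \<in> earlier_neighbours G r v"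
proof -
  have "r u \<noteq> r v"
    using assms neighbourhoodD by (metis inj_onD)
  then show thesis
    using that assms(2) neighbourhoodD(4) by (fastforce simp: earlier_neighbours_def)
qed

lemma (in pair_graph) first_neighbour_in_neighbourhood:
  "v \<in> neighbourhood G u \<Longrightarrow> first_neighbour G r u \<in> neighbourhood G u"
  unfolding first_neighbour_def by (metis arg_min_if_finite(1) empty_iff finite_neighbourhood)

lemma (in pair_graph) first_neighbour_less:
  assumes "inj_on r (pverts G)" "v \<in> neighbourhood G u" "v \<noteq> first_neighbour G r u"
  shows "r (first_neighbour G r u) < r v"
proof -
  have "r (first_neighbour G r u) \<le> r v"
    unfolding first_neighbour_def using assms(2) finite_neighbourhood by (auto intro: arg_min_least)
  moreover have "r (first_neighbour G r u) \<noteq> r v"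
    using assms first_neighbour_in_neighbourhood neighbourhoodD(2) by (metis inj_onD)
  ultimately show ?thesis by simp
qed

lemma (in pair_graph) finite_conflicts: "finite (conflicts G r w)"
  by (simp add: conflicts_def finite_earlier_neighbours finite_neighbourhood)

lemma odd_colouring_if_unique_colour:
  assumes "\<And>v. v \<in> pverts G \<Longrightarrow> neighbourhood G v \<noteq> {} \<Longrightarrow>
    \<exists>w\<in>neighbourhood G v. \<forall>w'\<in>neighbourhood G v. \<phi> w' = \<phi> w \<longrightarrow> w' = w"
  shows "odd_colouring G \<phi>"
  unfolding odd_colouring_def
proof (intro ballI impI)
  fix v assume "v \<in> pverts G" "card (neighbourhood G v) > 0"
  then obtain w where "w \<in> neighbourhood G v"
      "\<forall>w'\<in>neighbourhood G v. \<phi> w' = \<phi> w \<longrightarrow> w' = w"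
    using assms by force
  then have "{w' \<in> neighbourhood G v. \<phi> w' = \<phi> w} = {w}" by auto
  then have "odd (card {w' \<in> neighbourhood G v. \<phi> w' = \<phi> w})" by simp
  then show "\<exists>\<alpha>. odd (card {w' \<in> neighbourhood G v. \<phi> w' = \<alpha>})" by blast
qed

lemma (in pair_graph) proper_colouring_if_avoids_conflicts:
  assumes "inj_on r (pverts G)"
    and avoids: "\<And>w. w \<in> pverts G \<Longrightarrow> \<phi> w \<notin> \<phi> ` conflicts G r w"
  shows "proper_colouring G \<phi>"
proof -
  have "\<phi> u \<noteq> \<phi> v" if "v \<in> neighbourhood G u" for u v
    using assms(1) that
  proof (cases rule: earlier_neighbours_cases)
    case 1
    then have "v \<in> conflicts G r u" by (simp add: conflicts_def)
    then show ?thesis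
      using avoids[of u] neighbourhoodD(1)[OF that] by auto
  next
    case 2
    then have "u \<in> conflicts G r v" by (simp add: conflicts_def)
    then show ?thesis
      using avoids[of v] neighbourhoodD(2)[OF that] by (metis image_eqI)
  qed
  then show ?thesis by (auto simp: proper_colouring_def neighbourhood_def)
qed

lemma (in pair_graph) odd_colouring_if_avoids_conflicts:
  assumes "inj_on r (pverts G)"
    and avoids: "\<And>w. w \<in> pverts G \<Longrightarrow> \<phi> w \<notin> \<phi> ` conflicts G r w"
  shows "odd_colouring G \<phi>"
proof (rule odd_colouring_if_unique_colour)
  fix u assume "neighbourhood G u \<noteq> {}"
  let ?f = "first_neighbour G r u"
  have "w = ?f" if w: "w \<in> neighbourhood G u" and same_colour: "\<phi> w = \<phi> ?f" for w
  proof (rule ccontr)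
    assume "w \<noteq> ?f"
    with w have "?f \<in> conflicts G r w"
      using first_neighbour_less[OF assms(1)] neighbourhoodD(4)[OF w] by (simp add: conflicts_def)
    with same_colour show False
      using avoids[of w] neighbourhoodD(2)[OF w] by auto
  qed
  moreover have "?f \<in> neighbourhood G u"
    using \<open>neighbourhood G u \<noteq> {}\<close> first_neighbour_in_neighbourhood by blast
  ultimately show "\<exists>w\<in>neighbourhood G u. \<forall>w'\<in>neighbourhood G u. \<phi> w' = \<phi> w \<longrightarrow> w' = w"
    by blast
qed

theorem (in pair_graph) ex_proper_odd_colouring_if_card_conflicts_le:
  assumes "inj_on r (pverts G)"
    and card_le: "\<And>w. w \<in> pverts G \<Longrightarrow> card (conflicts G r w) \<le> k"
  shows "\<exists>\<phi>. proper_colouring G \<phi> \<and> odd_colouring G \<phi> \<and> num_colours G \<phi> \<le> k + 1"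
proof -
  have "\<exists>\<phi> :: 'a \<Rightarrow> nat. \<forall>w\<in>pverts G. \<phi> w \<le> k \<and> \<phi> w \<notin> \<phi> ` conflicts G r w"
  proof (rule greedy_colouring[OF pair_finite_verts finite_conflicts card_le])
    show "r u < r w" if "u \<in> conflicts G r w" for u w
      using that by (auto simp: conflicts_def earlier_neighbours_def)
  qed
  then obtain \<phi> :: "'a \<Rightarrow> nat" where
    greedy: "\<forall>w\<in>pverts G. \<phi> w \<le> k \<and> \<phi> w \<notin> \<phi> ` conflicts G r w"
    by blast
  then have "num_colours G \<phi> \<le> card {..k}"
    unfolding num_colours_def by (intro card_mono) auto
  moreover have "proper_colouring G \<phi>" "odd_colouring G \<phi>"
    using assms(1) greedy proper_colouring_if_avoids_conflicts odd_colouring_if_avoids_conflicts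
    by blast+
  ultimately show ?thesis by auto
qed


subsection \<open>Elimination orders of \<open>t\<close>-trees\<close>

definition elimination_rank ::
  "nat \<Rightarrow> 'a pair_pre_digraph \<Rightarrow> ('a \<Rightarrow> 'b::linorder) \<Rightarrow> bool" where
  "elimination_rank t H r \<longleftrightarrow> inj_on r (pverts H) \<and>
    (\<forall>y\<in>pverts H. card (earlier_neighbours H r y) \<le> t \<and> forms_clique H (earlier_neighbours H r y))"

lemma (in pair_graph) elimination_rank_if_clique:
  assumes "forms_clique G (pverts G)" "card (pverts G) \<le> Suc t" "inj_on r (pverts G)"
  shows "elimination_rank t G r"
proof -
  have earlier_subset: "earlier_neighbours G r y \<subseteq> pverts G - {y}" for y
    by (auto simp: earlier_neighbours_def dest: neighbourhoodD)
  have "card (earlier_neighbours G r y) \<le> t" if "y \<in> pverts G" for y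
    using card_mono[OF _ earlier_subset[of y]] that assms(2) pair_finite_verts by simp
  moreover have "forms_clique G (earlier_neighbours G r y)" for y
    using assms(1) earlier_subset by (auto simp: forms_clique_def)
  ultimately show ?thesis
    using assms(3) by (simp add: elimination_rank_def)
qed

lemma (in pair_graph) elimination_rank_add_simplicial:
  assumes "card (neighbourhood G v) \<le> t" "forms_clique G (neighbourhood G v)"
    and r: "elimination_rank t (delete_vertex G v) r"
    and less_m: "\<And>x. x \<in> pverts G \<Longrightarrow> r x < m"
  shows "elimination_rank t G (r(v := m))"
proof -
  let ?G' = "delete_vertex G v" and ?r' = "r(v := m)"
  have earlier_v: "earlier_neighbours G ?r' v = neighbourhood G v"
    using less_m neighbourhoodD(2,3) by (fastforce simp: earlier_neighbours_def)
  have earlier_other: "earlier_neighbours G ?r' y = earlier_neighbours ?G' r y"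
    if "y \<in> pverts G" "y \<noteq> v" for y
    using less_m[OF that(1)] that
    by (auto simp: earlier_neighbours_def neighbourhood_def delete_vertex_def)
  have clique_mono: "forms_clique G S" if "forms_clique ?G' S" for S
    using that by (auto simp: forms_clique_def delete_vertex_def)
  have "inj_on ?r' (pverts G)"
    using r less_m unfolding elimination_rank_def delete_vertex_def inj_on_def
    by (auto split: if_splits)
  moreover have "card (earlier_neighbours G ?r' y) \<le> t \<and> forms_clique G (earlier_neighbours G ?r' y)"
    if "y \<in> pverts G" for y
  proof (cases "y = v")
    case True
    then show ?thesis using earlier_v assms(1,2) by simp
  next
    case False
    with that have "y \<in> pverts ?G'" by (simp add: delete_vertex_def)
    with r earlier_other[OF that False] clique_mono show ?thesis
      by (simp add: elimination_rank_def)
  qed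
  ultimately show ?thesis
    by (simp add: elimination_rank_def)
qed

lemma t_tree_imp_pair_graph: "t_tree t H \<Longrightarrow> pair_graph H"
  by (cases rule: t_tree.cases) (auto simp: complete_digraph_def intro: pair_graphI_graph)

lemma t_tree_imp_ex_elimination_rank:
  assumes "t_tree t H"
  shows "\<exists>r :: 'a \<Rightarrow> nat. elimination_rank t (H :: 'a pair_pre_digraph) r"
  using assms
proof induction
  case (clique H)
  then interpret pair_graph H
    by (intro t_tree_imp_pair_graph t_tree.clique)
  obtain r :: "'a \<Rightarrow> nat" where "inj_on r (pverts H)"
    using finite_imp_inj_to_nat_seg[OF pair_finite_verts] by blast
  moreover have "forms_clique H (pverts H)" "card (pverts H) \<le> Suc t"
    using clique by (auto simp: complete_digraph_pair_def forms_clique_def)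
  ultimately show ?case
    using elimination_rank_if_clique by blast
next
  case (extend H v)
  then interpret pair_graph H by simp
  obtain r :: "'a \<Rightarrow> nat" where r: "elimination_rank t (delete_vertex H v) r"
    using extend.IH by blast
  have "r x < Suc (Max (r ` pverts H))" if "x \<in> pverts H" for x
    using that pair_finite_verts by (simp add: less_Suc_eq_le)
  with r show ?case
    using elimination_rank_add_simplicial extend.hyps by blast
qed

lemma (in pair_graph) elimination_rank_earlier_neighboursD:
  assumes r: "elimination_rank t G r"
    and "y \<in> insert x (earlier_neighbours G r x)" "z \<in> insert x (earlier_neighbours G r x)"
    and "x \<in> pverts G" "r z \<le> r y"
  shows "z \<in> insert y (earlier_neighbours G r y)"
proof (cases "z = y")
  case False
  have "forms_clique G (earlier_neighbours G r x)"
    using r \<open>x \<in> pverts G\<close> by (simp add: elimination_rank_def)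
  then have "z \<in> neighbourhood G y"
    if "y \<in> earlier_neighbours G r x" "z \<in> earlier_neighbours G r x"
    using that False by (auto simp: forms_clique_def neighbourhood_def)
  then have "z \<in> neighbourhood G y"
    using assms(2,3) False neighbourhoodD(4) by (auto simp: earlier_neighbours_def)
  moreover have "r z \<noteq> r y"
    using r False neighbourhoodD[OF \<open>z \<in> neighbourhood G y\<close>]
    by (auto simp: elimination_rank_def dest: inj_onD)
  ultimately show ?thesis
    using \<open>r z \<le> r y\<close> by (simp add: earlier_neighbours_def order_less_le)
qed simp


subsection \<open>Products with graphs of bounded bandwidth\<close>

definition bandwidth_layout :: "nat \<Rightarrow> 'a pair_pre_digraph \<Rightarrow> ('a \<Rightarrow> int) \<Rightarrow> bool" where
  "bandwidth_layout b P l \<longleftrightarrow> inj_on l (pverts P) \<and> (\<forall>(p, q)\<in>parcs P. \<bar>l p - l q\<bar> \<le> b)"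

lemma path_graph_imp_ex_bandwidth_layout:
  assumes "path_graph P"
  shows "\<exists>l. bandwidth_layout 1 P l"
proof -
  from assms obtain xs where xs: "distinct xs" "pverts P = set xs"
    "parcs P = {(xs ! i, xs ! j) | i j.
      i < length xs \<and> j < length xs \<and> (j = Suc i \<or> i = Suc j)}"
    unfolding path_graph_def by blast
  define l where "l = int \<circ> the_inv_into {..<length xs} ((!) xs)"
  have l_nth: "l (xs ! i) = int i" if "i < length xs" for i
    using that xs(1) by (simp add: l_def the_inv_into_f_f inj_on_nth)
  have "inj_on l (pverts P)"
    unfolding xs(2) by (rule inj_onI) (metis in_set_conv_nth l_nth of_nat_eq_iff)
  moreover have "\<bar>l p - l q\<bar> \<le> 1" if "(p, q) \<in> parcs P" for p q
    using that by (auto simp: xs(3) l_nth)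
  ultimately show ?thesis by (auto simp: bandwidth_layout_def)
qed

locale strong_product_subgraph =
  H: pair_graph H + G: pair_graph G
  for H :: "'a pair_pre_digraph" and G :: "('a \<times> 'b) pair_pre_digraph" +
  fixes P :: "'b pair_pre_digraph" and t b :: nat and r :: "'a \<Rightarrow> 'c::linorder" and l :: "'b \<Rightarrow> int"
  assumes elimination: "elimination_rank t H r"
    and layout: "bandwidth_layout b P l"
    and subgraph: "subgraph (with_proj G) (with_proj (H \<boxtimes> P))"
begin

abbreviation "lex_rank \<equiv> map_prod r l"

abbreviation "earlier_columns \<equiv> earlier_neighbours H r"

definition layers :: "int set \<Rightarrow> 'b set" where
  "layers I = l -` I \<inter> pverts P"

lemma finite_layers: "finite I \<Longrightarrow> finite (layers I)"
  using layout by (simp add: layers_def bandwidth_layout_def finite_vimage_IntI)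

lemma card_layers_le: "finite I \<Longrightarrow> card (layers I) \<le> card I"
  using layout by (simp add: layers_def bandwidth_layout_def card_vimage_inj_on_le)

lemma pvertsD:
  assumes "(x, p) \<in> pverts G"
  shows "x \<in> pverts H" "p \<in> pverts P"
  using assms subgraph by (auto simp: subgraph_def strong_product_def)

lemma inj_on_lex_rank: "inj_on lex_rank (pverts G)"
proof (rule inj_on_subset)
  show "inj_on lex_rank (pverts H \<times> pverts P)"
    using elimination layout by (simp add: elimination_rank_def bandwidth_layout_def map_prod_inj_on)
  show "pverts G \<subseteq> pverts H \<times> pverts P"
    using pvertsD by auto
qed

lemma neighbour_columnD:
  assumes "(y, q) \<in> neighbourhood G (x, p)"
  shows "x = y \<or> y \<in> earlier_columns x \<or> x \<in> earlier_columns y"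
proof -
  have "x = y \<or> y \<in> neighbourhood H x"
    using assms subgraph by (auto simp: neighbourhood_def subgraph_def strong_product_def)
  then show ?thesis
    using elimination H.earlier_neighbours_cases by (metis elimination_rank_def)
qed

lemma neighbour_layerD:
  assumes "(y, q) \<in> neighbourhood G (x, p)"
  shows "\<bar>l p - l q\<bar> \<le> b"
proof -
  have "p = q \<or> (p, q) \<in> parcs P"
    using assms subgraph by (auto simp: neighbourhood_def subgraph_def strong_product_def)
  then show ?thesis
    using layout by (auto simp: bandwidth_layout_def)
qed

definition earlier_box :: "'a \<Rightarrow> 'b \<Rightarrow> ('a \<times> 'b) set" where
  "earlier_box y j = {y} \<times> layers {l j - 2 * b..<l j} \<union>
    earlier_columns y \<times> layers {l j - 2 * b..l j + 2 * b}"

lemma in_earlier_boxI: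
  assumes "lex_rank (x, i) < lex_rank (y, j)" "i \<in> pverts P"
    and "x \<in> insert y (earlier_columns y)" "\<bar>l i - l j\<bar> \<le> 2 * b"
  shows "(x, i) \<in> earlier_box y j"
  using assms by (auto simp: earlier_box_def layers_def)

lemma earlier_neighbours_subset_earlier_box:
  "earlier_neighbours G lex_rank (y, j) \<subseteq> earlier_box y j"
proof (rule subrelI)
  fix x i assume earlier: "(x, i) \<in> earlier_neighbours G lex_rank (y, j)"
  then have neighbour: "(x, i) \<in> neighbourhood G (y, j)"
    and less: "lex_rank (x, i) < lex_rank (y, j)"
    by (simp_all add: earlier_neighbours_def)
  show "(x, i) \<in> earlier_box y j"
  proof (rule in_earlier_boxI[OF less])
    show "i \<in> pverts P"
      using G.neighbourhoodD(2)[OF neighbour] pvertsD(2) by blast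
    show "x \<in> insert y (earlier_columns y)"
      using neighbour_columnD[OF neighbour] less by (auto simp: earlier_neighbours_def)
    show "\<bar>l i - l j\<bar> \<le> 2 * b"
      using neighbour_layerD[OF neighbour] by simp
  qed
qed

lemma first_neighbour_column:
  assumes x: "(x, i) \<in> neighbourhood G (y, j)"
    and z: "(z, k) \<in> neighbourhood G (x, i)" "r z \<le> r y"
    and x_not_earlier: "x \<notin> earlier_columns y"
  shows "z \<in> insert y (earlier_columns y)"
proof (rule H.elimination_rank_earlier_neighboursD[OF elimination])
  show "y \<in> insert x (earlier_columns x)"
    using neighbour_columnD[OF x] x_not_earlier by auto
  then have "r z \<le> r x"
    using z(2) by (auto simp: earlier_neighbours_def)
  then show "z \<in> insert x (earlier_columns x)"
    using neighbour_columnD[OF z(1)] by (auto simp: earlier_neighbours_def)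
  show "x \<in> pverts H"
    using pvertsD(1) G.neighbourhoodD(2)[OF x] .
qed fact

lemma earlier_first_neighbour_cases:
  assumes u: "u \<in> neighbourhood G (y, j)"
    and less: "lex_rank (first_neighbour G lex_rank u) < lex_rank (y, j)"
  obtains "u \<in> earlier_columns y \<times> layers {l j - b..l j + b}"
    | "first_neighbour G lex_rank u \<in> earlier_box y j"
proof -
  obtain x i where u_eq: "u = (x, i)" by force
  obtain z k where first_eq: "first_neighbour G lex_rank u = (z, k)" by force
  have first_adj: "(z, k) \<in> neighbourhood G (x, i)"
    using G.first_neighbour_in_neighbourhood[OF G.neighbourhoodD(4)[OF u]]
    by (metis first_eq u_eq)
  have near: "\<bar>l j - l i\<bar> \<le> b" "\<bar>l i - l k\<bar> \<le> b"
    using neighbour_layerD u first_adj by (simp_all add: u_eq)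
  have path_verts: "i \<in> pverts P" "k \<in> pverts P"
    using G.neighbourhoodD(1,2)[OF first_adj] pvertsD(2) by blast+
  show thesis
  proof (cases "x \<in> earlier_columns y")
    case True
    then have "u \<in> earlier_columns y \<times> layers {l j - b..l j + b}"
      using near(1) path_verts(1) by (simp add: u_eq layers_def abs_le_iff)
    then show thesis by (rule that)
  next
    case False
    have "z \<in> insert y (earlier_columns y)"
      using first_neighbour_column[OF _ first_adj _ False] u less
      by (auto simp: u_eq first_eq[unfolded u_eq])
    moreover have "\<bar>l k - l j\<bar> \<le> 2 * b"
      using near by linarith
    ultimately have "first_neighbour G lex_rank u \<in> earlier_box y j"
      using in_earlier_boxI[OF _ path_verts(2)] less unfolding first_eq by blast
    then show thesis by (rule that)
  qed
qed

lemma conflicts_subset: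
  "conflicts G lex_rank (y, j) \<subseteq> earlier_box y j \<union>
    first_neighbour G lex_rank ` (earlier_columns y \<times> layers {l j - b..l j + b})"
  using earlier_neighbours_subset_earlier_box
  by (auto simp: conflicts_def simp del: map_prod_simp elim: earlier_first_neighbour_cases)

lemma card_conflicts_le:
  assumes "w \<in> pverts G"
  shows "card (conflicts G lex_rank w) \<le> (6 * b + 2) * t + 2 * b"
proof -
  obtain y j where w: "w = (y, j)" by force
  let ?same = "{y} \<times> layers {l j - 2 * b..<l j}"
  let ?earlier = "earlier_columns y \<times> layers {l j - 2 * b..l j + 2 * b}"
  let ?sources = "earlier_columns y \<times> layers {l j - b..l j + b}"
  let ?firsts = "first_neighbour G lex_rank ` ?sources"
  have finite_boxes: "finite ?same" "finite ?earlier" "finite ?sources"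
    by (simp_all add: finite_layers H.finite_earlier_neighbours)
  have card_columns: "card (earlier_columns y) \<le> t"
    using elimination pvertsD(1) assms by (simp add: w elimination_rank_def)
  have "card (conflicts G lex_rank w) \<le> card (?same \<union> ?earlier \<union> ?firsts)"
    unfolding w using finite_boxes conflicts_subset
    by (intro card_mono) (auto simp: earlier_box_def)
  also have "\<dots> \<le> card ?same + card ?earlier + card ?firsts"
    by (meson add_le_mono card_Un_le order_refl order_trans)
  also have "\<dots> \<le> 2 * b + t * (4 * b + 1) + t * (2 * b + 1)"
  proof (intro add_mono)
    show "card ?same \<le> 2 * b"
      using card_layers_le[of "{l j - 2 * b..<l j}"] by (simp add: card_cartesian_product)
    show "card ?earlier \<le> t * (4 * b + 1)"
      unfolding card_cartesian_product
      using card_columns by (intro mult_le_mono order_trans[OF card_layers_le]) auto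
    have "card ?sources \<le> t * (2 * b + 1)"
      unfolding card_cartesian_product
      using card_columns by (intro mult_le_mono order_trans[OF card_layers_le]) auto
    then show "card ?firsts \<le> t * (2 * b + 1)"
      by (rule order_trans[OF card_image_le[OF finite_boxes(3)]])
  qed
  finally show ?thesis by (simp add: algebra_simps)
qed

theorem ex_proper_odd_colouring:
  "\<exists>\<phi>. proper_colouring G \<phi> \<and> odd_colouring G \<phi> \<and> num_colours G \<phi> \<le> (6 * b + 2) * t + 2 * b + 1"
  using G.ex_proper_odd_colouring_if_card_conflicts_le[OF inj_on_lex_rank card_conflicts_le] .

end

theorem theorem1:
  fixes t :: nat
    and H :: "'a pair_pre_digraph"
    and P :: "'b pair_pre_digraph"
    and G :: "('a \<times> 'b) pair_pre_digraph"
  assumes "t_tree t H"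
    and "path_graph P"
    and "pair_graph G"
    and "subgraph (with_proj G) (with_proj (H \<boxtimes> P))"
  shows "\<exists>\<phi>. proper_colouring G \<phi> \<and> odd_colouring G \<phi> \<and> num_colours G \<phi> \<le> 8 * t + 4"
proof -
  obtain r :: "'a \<Rightarrow> nat" where r: "elimination_rank t H r"
    using t_tree_imp_ex_elimination_rank[OF assms(1)] by blast
  obtain l where l: "bandwidth_layout 1 P l"
    using path_graph_imp_ex_bandwidth_layout[OF assms(2)] by blast
  interpret strong_product_subgraph H G P t 1 r l
    using t_tree_imp_pair_graph[OF assms(1)] assms(3,4) r l
    by (simp add: strong_product_subgraph_def strong_product_subgraph_axioms_def)
  obtain \<phi> where "proper_colouring G \<phi>" "odd_colouring G \<phi>" "num_colours G \<phi> \<le> 8 * t + 3"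
    using ex_proper_odd_colouring by auto
  then show ?thesis
    by (intro exI[of _ \<phi>]) simp
qed

end
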